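(* Let $\varepsilon \in (0,1)$ be arbitrary. There exist $C > 0$ and $d_0 \in \mathbb{N}$ such that for every integer $d \ge d_0$ and every real $f$ with $C \le f \le d^2+1$, if $G$ is a $d$-degenerate graph that admits a left $\frac{d^2}{f}$-locally-sparse degeneracy ordering, then $$\chi_f^{\mathrm{DP}}(G) \le (8+\varepsilon)\frac{d}{\log f}.$$
   Context: All graphs are finite, simple and undirected; $\log$ is the natural logarithm. A graph is $d$-degenerate if it admits a vertex ordering $(v_1,\dots,v_n)$ in which each $v_i$ has at most $d$ back-neighbors, i.e. neighbors $v_j$ with $j<i$; such an ordering is called a degeneracy ordering. For $k \in \mathbb{R}$, an ordering $(v_1,\dots,v_n)$ of $V(G)$ is left $k$-locally-sparse if for each $i$ the induced subgraph $G[N(v_i)\cap\{v_1,\dots,v_{i-1}\}]$ has at most $\lfloor k\rfloor$ edges. A left $k$-locally-sparse degeneracy ordering is a single ordering having both properties (at most $d$ back-neighbors per vertex and left $k$-locally-sparse). A DP-cover (correspondence cover) of $G$ is a pair $\mathcal{H}=(L,H)$ where $H$ is a graph and $L:V(G)\to 2^{V(H)}$ satisfies: (DP1) $\{L(v):v\in V(G)\}$ is a partition of $V(H)$; (DP2) each $L(v)$ is an independent set in $H$; (DP3) for all distinct $u,v\in V(G)$, the edge set of $H[L(u)\cup L(v)]$ is a matching, empty if $uv\notin E(G)$. It is $q$-fold if $|L(v)|=q$ for all $v$. For $\eta\in[0,1]$, an $(\eta,\mathcal{H})$-coloring of $G$ is an independent set $S\subseteq V(H)$ with $|S\cap L(u)|\ge\eta|L(u)|$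 for all $u\in V(G)$. For $q\in\mathbb{N}^+$ let $\theta_{\mathrm{DP}}(G,q)$ be the maximum $\eta\in[0,1]$ such that $G$ admits an $(\eta,\mathcal{H})$-coloring for every $q$-fold DP-cover $\mathcal{H}$ of $G$. The fractional DP-chromatic number is $\chi_f^{\mathrm{DP}}(G)=\inf\{\theta_{\mathrm{DP}}(G,q)^{-1}: q\in\mathbb{N}^+\}$. *)

theory Defs
  imports "HOL-Analysis.Analysis" "Graph_Theory.Graph_Theory"
begin

text \<open>
  Finite simple undirected graphs are the structures satisfying \<^const>\<open>pair_graph\<close>: an undirected
  edge \<open>uv\<close> is the pair of arcs \<open>(u,v)\<close>, \<open>(v,u)\<close>. Wherever edges are counted or compared we
  therefore pass to the set of two-element sets \<open>{u,v}\<close>, so that each edge counts once.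
\<close>

definition edge_set :: "('a, 'b) pre_digraph \<Rightarrow> 'a set set" where
  "edge_set G = {{u, v} | u v. u \<rightarrow>\<^bsub>G\<^esub> v}"

definition independent_set :: "'a pair_pre_digraph \<Rightarrow> 'a set \<Rightarrow> bool" where
  "independent_set G S \<longleftrightarrow> S \<subseteq> pverts G \<and> (\<forall>u\<in>S. \<forall>v\<in>S. \<not> u \<rightarrow>\<^bsub>G\<^esub> v)"

definition matching :: "'a set set \<Rightarrow> bool" where
  "matching M \<longleftrightarrow> pairwise disjnt M"


subsection \<open>Degeneracy and local sparsity\<close>

text \<open>An ordering \<open>(v\<^sub>1,\<dots>,v\<^sub>n)\<close> is a list; its positions are counted from \<open>0\<close>.\<close>

definition vertex_ordering :: "'a pair_pre_digraph \<Rightarrow> 'a list \<Rightarrow> bool" where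
  "vertex_ordering G vs \<longleftrightarrow> distinct vs \<and> set vs = pverts G"

definition back_nbrs :: "'a pair_pre_digraph \<Rightarrow> 'a list \<Rightarrow> nat \<Rightarrow> 'a set" where
  "back_nbrs G vs i = {vs ! j | j. j < i \<and> vs ! j \<rightarrow>\<^bsub>G\<^esub> vs ! i}"

definition degeneracy_ordering :: "nat \<Rightarrow> 'a pair_pre_digraph \<Rightarrow> 'a list \<Rightarrow> bool" where
  "degeneracy_ordering d G vs \<longleftrightarrow>
     vertex_ordering G vs \<and> (\<forall>i<length vs. card (back_nbrs G vs i) \<le> d)"

definition degenerate :: "nat \<Rightarrow> 'a pair_pre_digraph \<Rightarrow> bool" where
  "degenerate d G \<longleftrightarrow> (\<exists>vs. degeneracy_ordering d G vs)"

definition left_locally_sparse :: "real \<Rightarrow> 'a pair_pre_digraph \<Rightarrow> 'a list \<Rightarrow> bool" where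
  "left_locally_sparse k G vs \<longleftrightarrow>
     vertex_ordering G vs \<and>
     (\<forall>i<length vs. int (card (edge_set (G \<restriction> back_nbrs G vs i))) \<le> \<lfloor>k\<rfloor>)"


subsection \<open>DP-covers and fractional DP-colouring\<close>

text \<open>
  The partition condition is meant for the indexed family \<open>(L v)\<close>: distinct vertices have disjoint
  lists.
\<close>

definition DP_cover ::
  "'a pair_pre_digraph \<Rightarrow> ('a \<Rightarrow> 'b set) \<Rightarrow> 'b pair_pre_digraph \<Rightarrow> bool" where
  "DP_cover G L H \<longleftrightarrow>
     pair_graph H \<and>
     (\<Union>v\<in>pverts G. L v) = pverts H \<and> disjoint_family_on L (pverts G) \<and>
     (\<forall>v\<in>pverts G. independent_set H (L v)) \<and>
     (\<forall>u\<in>pverts G. \<forall>v\<in>pverts G. u \<noteq> v \<longrightarrow>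
        matching (edge_set (H \<restriction> (L u \<union> L v))) \<and>
        (\<not> u \<rightarrow>\<^bsub>G\<^esub> v \<longrightarrow> edge_set (H \<restriction> (L u \<union> L v)) = {}))"

definition q_fold :: "'a pair_pre_digraph \<Rightarrow> nat \<Rightarrow> ('a \<Rightarrow> 'b set) \<Rightarrow> bool" where
  "q_fold G q L \<longleftrightarrow> (\<forall>v\<in>pverts G. card (L v) = q)"

definition frac_coloring ::
  "'a pair_pre_digraph \<Rightarrow> real \<Rightarrow> ('a \<Rightarrow> 'b set) \<Rightarrow> 'b pair_pre_digraph \<Rightarrow> 'b set \<Rightarrow> bool" where
  "frac_coloring G \<eta> L H S \<longleftrightarrow>
     independent_set H S \<and>
     (\<forall>u\<in>pverts G. real (card (S \<inter> L u)) \<ge> \<eta> * real (card (L u)))"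

text \<open>
  A formula cannot quantify over the type of the vertices of \<open>H\<close>. Cover graphs are finite, so
  the type \<^typ>\<open>nat\<close> loses nothing; see \<open>DP_admissible_any_type\<close> below.
\<close>

definition DP_admissible :: "'a pair_pre_digraph \<Rightarrow> nat \<Rightarrow> real set" where
  "DP_admissible G q = {\<eta>. 0 \<le> \<eta> \<and> \<eta> \<le> 1 \<and>
     (\<forall>(L :: 'a \<Rightarrow> nat set) H. DP_cover G L H \<and> q_fold G q L \<longrightarrow>
        (\<exists>S. frac_coloring G \<eta> L H S))}"

text \<open>The supremum is a maximum: see \<open>\<theta>DP_max\<close> below.\<close>

definition \<theta>DP :: "'a pair_pre_digraph \<Rightarrow> nat \<Rightarrow> real" where
  "\<theta>DP G q = Sup (DP_admissible G q)"

text \<open>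
  \<open>\<theta>DP G q\<close> may be \<open>0\<close>, in which case its inverse is \<open>\<infinity>\<close>; hence the extended reals, as \<open>inverse 0\<close>
  is \<open>0\<close> in \<^typ>\<open>real\<close>.
\<close>

definition \<chi>fDP :: "'a pair_pre_digraph \<Rightarrow> ereal" where
  "\<chi>fDP G = (INF q\<in>{1..}. inverse (ereal (\<theta>DP G q)))"


subsection \<open>Justification of the encodings\<close>

lemma zero_DP_admissible: "0 \<in> DP_admissible G q"
  by (auto simp: DP_admissible_def frac_coloring_def independent_set_def intro: exI[of _ "{}"])

lemma DP_admissible_le_1: "\<eta> \<in> DP_admissible G q \<Longrightarrow> \<eta> \<le> 1"
  by (simp add: DP_admissible_def)

lemma \<theta>DP_admissible:
  assumes "q \<ge> 1"
  shows "\<theta>DP G q \<in> DP_admissible G q"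
proof -
  let ?s = "\<theta>DP G q"
  have bdd: "bdd_above (DP_admissible G q)"
    by (auto intro: bdd_aboveI DP_admissible_le_1)
  have s0: "0 \<le> ?s"
    unfolding \<theta>DP_def by (rule cSup_upper[OF zero_DP_admissible bdd])
  have s1: "?s \<le> 1"
    unfolding \<theta>DP_def using zero_DP_admissible DP_admissible_le_1 by (metis cSup_least empty_iff)
  have "(of_int \<lceil>?s * q\<rceil> - 1) / q < ?s"
    using assms by (simp add: divide_less_eq) linarith
  then obtain \<eta> where \<eta>: "\<eta> \<in> DP_admissible G q" "(of_int \<lceil>?s * q\<rceil> - 1) / q < \<eta>"
    unfolding \<theta>DP_def using less_cSup_iff[OF _ bdd] zero_DP_admissible by (metis empty_iff)
  have gap: "?s * q \<le> real m" if "\<eta> * q \<le> real m" for m :: nat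
  proof -
    have "of_int \<lceil>?s * q\<rceil> - 1 < \<eta> * q"
      using \<eta>(2) assms by (simp add: divide_less_eq)
    with that have "of_int \<lceil>?s * q\<rceil> - 1 < real m" by linarith
    then have "\<lceil>?s * q\<rceil> \<le> int m" by linarith
    then show ?thesis by (simp add: ceiling_le_iff)
  qed
  have "\<exists>S. frac_coloring G ?s L H S" if "DP_cover G L H" "q_fold G q L"
    for L :: "'a \<Rightarrow> nat set" and H
  proof -
    from \<eta>(1) that obtain S where "frac_coloring G \<eta> L H S"
      by (auto simp: DP_admissible_def)
    with that(2) gap have "frac_coloring G ?s L H S"
      by (auto simp: frac_coloring_def q_fold_def)
    then show ?thesis ..
  qed
  with s0 s1 show ?thesis by (auto simp: DP_admissible_def)
qed

lemma \<theta>DP_max: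
  assumes "q \<ge> 1"
  shows "\<theta>DP G q = (GREATEST \<eta>. \<eta> \<in> DP_admissible G q)"
proof (rule sym, rule Greatest_equality)
  show "\<theta>DP G q \<in> DP_admissible G q" using assms by (rule \<theta>DP_admissible)
  show "\<eta> \<le> \<theta>DP G q" if "\<eta> \<in> DP_admissible G q" for \<eta>
    unfolding \<theta>DP_def using that by (rule cSup_upper) (auto intro: bdd_aboveI DP_admissible_le_1)
qed

lemma DP_admissible_any_type:
  fixes L :: "'a \<Rightarrow> 'b set"
  assumes \<eta>: "\<eta> \<in> DP_admissible G q" and cover: "DP_cover G L H" and fold: "q_fold G q L"
  shows "\<exists>S. frac_coloring G \<eta> L H S"
proof -
  interpret H: pair_graph H using cover by (simp add: DP_cover_def)
  obtain h :: "'b \<Rightarrow> nat" where h: "inj_on h (pverts H)"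
    using finite_imp_inj_to_nat_seg[OF H.pair_finite_verts] by blast
  have LH: "L v \<subseteq> pverts H" if "v \<in> pverts G" for v
    using cover that by (auto simp: DP_cover_def)
  define H' where "H' = \<lparr>pverts = h ` pverts H, parcs = map_prod h h ` parcs H\<rparr>"
  define L' where "L' = (\<lambda>v. h ` L v)"
  have adj: "h x \<rightarrow>\<^bsub>H'\<^esub> h y \<longleftrightarrow> x \<rightarrow>\<^bsub>H\<^esub> y" if "x \<in> pverts H" "y \<in> pverts H" for x y
  proof
    assume "h x \<rightarrow>\<^bsub>H'\<^esub> h y"
    then obtain a b where ab: "(a, b) \<in> parcs H" "h x = h a" "h y = h b"
      by (auto simp: H'_def)
    then have "x = a" "y = b" using h that by (auto simp: inj_on_def dest: H.in_arcsD1 H.in_arcsD2)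
    with ab show "x \<rightarrow>\<^bsub>H\<^esub> y" by simp
  qed (auto simp: H'_def)
  have pg: "pair_graph H'"
  proof unfold_locales
    show "symmetric (with_proj H')"
      using H.pair_sym_arcs unfolding symmetric_def sym_def H'_def by fastforce
  next
    fix e assume "e \<in> parcs H'"
    then obtain a b where ab: "(a, b) \<in> parcs H" "e = (h a, h b)" by (auto simp: H'_def)
    then show "fst e \<noteq> snd e"
      using h H.no_loops'[OF ab(1)] by (auto simp: inj_on_def dest: H.in_arcsD1 H.in_arcsD2)
  qed (auto simp: H'_def H.pair_finite_verts H.pair_finite_arcs dest: H.in_arcsD1 H.in_arcsD2)
  have edges: "edge_set (H' \<restriction> (h ` A)) = (`) h ` edge_set (H \<restriction> A)" if A: "A \<subseteq> pverts H" for A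
  proof -
    have 1: "edge_set (K \<restriction> B) = {{u, v} | u v. u \<in> B \<and> v \<in> B \<and> u \<rightarrow>\<^bsub>K\<^esub> v}"
      for K :: "'c pair_pre_digraph" and B
      by (auto simp: edge_set_def arcs_ends_conv)
    show ?thesis
    proof (intro equalityI subsetI)
      fix e assume "e \<in> edge_set (H' \<restriction> (h ` A))"
      then obtain x y where xy: "x \<in> A" "y \<in> A" "h x \<rightarrow>\<^bsub>H'\<^esub> h y" "e = h ` {x, y}"
        by (auto simp: 1)
      then have "x \<rightarrow>\<^bsub>H\<^esub> y" using adj A by blast
      with xy have "{x, y} \<in> edge_set (H \<restriction> A)" unfolding 1 by blast
      with xy(4) show "e \<in> (`) h ` edge_set (H \<restriction> A)" by blast
    next
      fix e assume "e \<in> (`) h ` edge_set (H \<restriction> A)"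
      then obtain x y where xy: "x \<in> A" "y \<in> A" "x \<rightarrow>\<^bsub>H\<^esub> y" "e = {h x, h y}"
        by (auto simp: 1)
      then have "h x \<rightarrow>\<^bsub>H'\<^esub> h y" using adj A by blast
      with xy show "e \<in> edge_set (H' \<restriction> (h ` A))" by (auto simp: 1)
    qed
  qed
  have match: "matching (edge_set (H' \<restriction> (h ` A)))"
    if A: "A \<subseteq> pverts H" and m: "matching (edge_set (H \<restriction> A))" for A
  proof -
    have sub: "e \<subseteq> pverts H" if "e \<in> edge_set (H \<restriction> A)" for e
      using that A by (auto simp: edge_set_def arcs_ends_conv)
    show ?thesis unfolding edges[OF A] matching_def pairwise_image
    proof (rule pairwiseI, rule impI)
      fix e e' assume *: "e \<in> edge_set (H \<restriction> A)" "e' \<in> edge_set (H \<restriction> A)" "e \<noteq> e'"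
      then have "e \<inter> e' = {}" using m by (auto simp: matching_def pairwise_def disjnt_def)
      then show "disjnt (h ` e) (h ` e')"
        using inj_on_image_Int[OF h sub[OF *(1)] sub[OF *(2)]] by (simp add: disjnt_def)
    qed
  qed
  have "DP_cover G L' H'"
    unfolding DP_cover_def
  proof (intro conjI ballI impI)
    show "pair_graph H'" by (rule pg)
    show "(\<Union>v\<in>pverts G. L' v) = pverts H'"
      using cover by (simp add: DP_cover_def L'_def H'_def flip: image_UN)
    show "disjoint_family_on L' (pverts G)"
      unfolding disjoint_family_on_def L'_def
    proof (intro ballI impI)
      fix u v assume *: "u \<in> pverts G" "v \<in> pverts G" "u \<noteq> v"
      then have "L u \<inter> L v = {}" using cover by (auto simp: DP_cover_def disjoint_family_on_def)
      then show "h ` L u \<inter> h ` L v = {}"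
        using inj_on_image_Int[OF h LH[OF *(1)] LH[OF *(2)]] by simp
    qed
    show "independent_set H' (L' v)" if "v \<in> pverts G" for v
    proof -
      have "independent_set H (L v)" using cover that by (simp add: DP_cover_def)
      then show ?thesis using adj LH[OF that]
        by (fastforce simp: independent_set_def L'_def H'_def)
    qed
  next
    fix u v assume *: "u \<in> pverts G" "v \<in> pverts G" "u \<noteq> v"
    have uv: "L u \<union> L v \<subseteq> pverts H" using * LH by blast
    have eq: "L' u \<union> L' v = h ` (L u \<union> L v)" by (auto simp: L'_def)
    show "matching (edge_set (H' \<restriction> (L' u \<union> L' v)))"
      unfolding eq using match[OF uv] cover * by (simp add: DP_cover_def)
    show "edge_set (H' \<restriction> (L' u \<union> L' v)) = {}" if "\<not> u \<rightarrow>\<^bsub>G\<^esub> v"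
      unfolding eq edges[OF uv] using cover * that by (simp add: DP_cover_def)
  qed
  moreover have cardL: "card (L' v) = card (L v)" if "v \<in> pverts G" for v
    unfolding L'_def using card_image inj_on_subset[OF h LH[OF that]] by blast
  then have "q_fold G q L'" using fold by (simp add: q_fold_def)
  ultimately obtain S' where S': "frac_coloring G \<eta> L' H' S'"
    using \<eta> by (auto simp: DP_admissible_def)
  define S where "S = {x \<in> pverts H. h x \<in> S'}"
  have "independent_set H S"
    using S' adj unfolding S_def frac_coloring_def independent_set_def by blast
  moreover have "\<eta> * card (L u) \<le> card (S \<inter> L u)" if u: "u \<in> pverts G" for u
  proof -
    have "S' \<inter> L' u = h ` (S \<inter> L u)" using LH[OF u] by (auto simp: S_def L'_def)
    moreover have "inj_on h (S \<inter> L u)" using h by (rule inj_on_subset) (auto simp: S_def)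
    ultimately have "card (S' \<inter> L' u) = card (S \<inter> L u)" by (simp add: card_image)
    then show ?thesis using S' u cardL[OF u] unfolding frac_coloring_def by metis
  qed
  ultimately have "frac_coloring G \<eta> L H S" by (simp add: frac_coloring_def)
  then show ?thesis ..
qed

end

theory Submission
  imports Defs "HOL-Real_Asymp.Real_Asymp"
begin

text \<open>
  Order the vertices of the cover graph along the degeneracy ordering and give each the weight \<open>p\<close>.
  Process them in turn: a vertex whose current weight is at most \<open>\<tau>\<close> is chosen with probability equal
  to its weight; if it is chosen, the weights of its later neighbours drop to \<open>0\<close>, otherwise they are
  divided by one minus that probability. The chosen set is independent and each weight is a martingale,
  so \<open>u\<close> is chosen with probability \<open>p\<close> minus the part of the expected final weight that lies above
  \<open>\<tau>\<close>. For a weight above \<open>\<tau>\<close> the choice probabilities of the earlier neighbours of \<open>u\<close> sum to at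
  least \<open>(1 - \<tau>) ln (\<tau> / p)\<close>, while, tilted by the weight of \<open>u\<close>, that sum has mean about \<open>d p\<close>
  because there are few edges between these neighbours. With \<open>p = ln f / (4 d)\<close> and
  \<open>\<tau> = sqrt f / (d ln f)\<close> Markov's inequality bounds the loss by about one half of \<open>p\<close>.

  Each vertex of the cover depends on boundedly many others, with a bound that does not involve \<open>q\<close>.
  So for large \<open>q\<close> a variance estimate yields one independent set that is good in all lists at once.
\<close>

subsection \<open>The random process\<close>

lemma pos_if_less_mult: "real k < c * real q \<Longrightarrow> 0 < q"
  by (cases "q = 0") auto

lemma card_relpow_Image_le:
  fixes R :: "('a \<times> 'a) set"
  assumes "\<And>x. finite (R `` {x})" "\<And>x. card (R `` {x}) \<le> D"
  shows "finite ((R ^^ k) `` {x}) \<and> card ((R ^^ k) `` {x}) \<le> D ^ k"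
proof (induction k)
  case (Suc k)
  have eq: "(R ^^ Suc k) `` {x} = (\<Union>y\<in>(R ^^ k) `` {x}. R `` {y})" by auto
  have "card (\<Union>y\<in>(R ^^ k) `` {x}. R `` {y}) \<le> (\<Sum>y\<in>(R ^^ k) `` {x}. card (R `` {y}))"
    using Suc.IH by (intro card_UN_le) simp
  also have "\<dots> \<le> (\<Sum>y\<in>(R ^^ k) `` {x}. D)" by (intro sum_mono assms(2))
  also have "\<dots> \<le> D ^ Suc k" using Suc.IH by simp
  finally show ?case unfolding eq using Suc.IH assms(1) by auto
qed auto

text \<open>\<open>B i\<close> is the set of earlier neighbours of \<open>i\<close>.\<close>

locale weight_process =
  fixes B :: "nat \<Rightarrow> nat set" and p \<tau> :: real
  assumes earlier: "B i \<subseteq> {..<i}"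
    and p_pos: "0 < p" and tau_pos: "0 < \<tau>" and tau_less_1: "\<tau> < 1"
begin

text \<open>
  \<open>prob I i\<close> is the probability of choosing \<open>i\<close> when \<open>I\<close> is the set chosen so far; \<open>wt m u I\<close> is the
  weight of \<open>u\<close> after the vertices below \<open>m\<close> have been processed.
\<close>

function prob :: "nat set \<Rightarrow> nat \<Rightarrow> real" where
  "prob I i =
     (let w = p * (\<Prod>j\<in>{..<i}. if j \<in> B i then if j \<in> I then 0 else 1 / (1 - prob I j) else 1)
      in if w \<le> \<tau> then w else 0)"
  by pat_completeness auto
termination by (relation "Wellfounded.measure snd") auto

declare prob.simps [simp del]

definition wt :: "nat \<Rightarrow> nat \<Rightarrow> nat set \<Rightarrow> real" where
  "wt m u I = p * (\<Prod>j\<in>B u \<inter> {..<m}. if j \<in> I then 0 else 1 / (1 - prob I j))"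

lemma prob_eq: "prob I i = (if wt i i I \<le> \<tau> then wt i i I else 0)"
proof -
  have "(\<Prod>j\<in>{..<i}. if j \<in> B i then if j \<in> I then 0 else 1 / (1 - prob I j) else 1)
      = (\<Prod>j\<in>B i \<inter> {..<i}. if j \<in> I then 0 else 1 / (1 - prob I j))"
    by (subst Int_commute, subst prod.inter_restrict) auto
  then show ?thesis by (subst prob.simps) (simp add: wt_def Let_def)
qed

lemma prob_le_tau: "prob I i \<le> \<tau>"
  using tau_pos by (simp add: prob_eq)

lemma prob_less_1: "prob I i < 1"
  using prob_le_tau tau_less_1 by (rule le_less_trans)

lemma wt_nonneg: "0 \<le> wt m u I"
proof -
  have "0 \<le> (\<Prod>j\<in>B u \<inter> {..<m}. if j \<in> I then 0 else 1 / (1 - prob I j))"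
    using prob_less_1 by (intro prod_nonneg) (simp add: less_imp_le)
  then show ?thesis using p_pos by (simp add: wt_def)
qed

lemma prob_nonneg: "0 \<le> prob I i"
  using wt_nonneg by (simp add: prob_eq)

lemma prob_le_wt: "prob I i \<le> wt i i I"
  using wt_nonneg by (simp add: prob_eq)

section \<open>Histories that determine the choice probabilities\<close>

definition back_closed :: "nat set \<Rightarrow> bool" where
  "back_closed A \<longleftrightarrow> (\<forall>x\<in>A. B x \<subseteq> A)"

lemma back_closed_lessThan: "back_closed {..<m}"
  using earlier unfolding back_closed_def by fastforce

text \<open>By induction on \<open>i\<close>: the weight of \<open>i\<close> reads only the members
  of \<open>B i\<close>, and back-closure lets the hypothesis apply to each of them.\<close>

lemma prob_cong:
  assumes "back_closed A" "B i \<subseteq> A" "I \<inter> A = J \<inter> A"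
  shows "prob I i = prob J i"
  using assms(2)
proof (induction i rule: less_induct)
  case (less i)
  have "wt i i I = wt i i J"
    unfolding wt_def
  proof (intro arg_cong[where f = "(*) p"] prod.cong refl)
    fix j assume j: "j \<in> B i \<inter> {..<i}"
    then have "j \<in> A" "prob I j = prob J j"
      using less assms(1) by (auto simp: back_closed_def)
    moreover from this have "j \<in> I \<longleftrightarrow> j \<in> J" using assms(3) by blast
    ultimately show "(if j \<in> I then 0 else 1 / (1 - prob I j)) = (if j \<in> J then 0 else 1 / (1 - prob J j))"
      by simp
  qed
  then show ?case by (simp add: prob_eq)
qed

lemma prob_insert: "i \<le> m \<Longrightarrow> prob (insert m I) i = prob I i"
  by (rule prob_cong[OF back_closed_lessThan[of i] earlier]) auto

lemma wt_Suc_insert: "wt (Suc m) u (insert m I) = (if m \<in> B u then 0 else wt m u I)"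
proof (cases "m \<in> B u")
  case True
  then have "m \<in> B u \<inter> {..<Suc m}" by simp
  then have "(\<Prod>j\<in>B u \<inter> {..<Suc m}. if j \<in> insert m I then 0 else 1 / (1 - prob (insert m I) j)) = 0"
    by (intro prod_zero) auto
  with True show ?thesis by (simp add: wt_def)
next
  case False
  then have eq: "B u \<inter> {..<Suc m} = B u \<inter> {..<m}" by (auto simp: less_Suc_eq)
  have "(\<Prod>j\<in>B u \<inter> {..<m}. if j \<in> insert m I then 0 else 1 / (1 - prob (insert m I) j))
      = (\<Prod>j\<in>B u \<inter> {..<m}. if j \<in> I then 0 else 1 / (1 - prob I j))"
    by (rule prod.cong) (use prob_insert in \<open>simp_all add: less_imp_le\<close>)
  then show ?thesis using False by (simp add: wt_def eq)
qed

lemma wt_Suc: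
  assumes "m \<notin> I"
  shows "wt (Suc m) u I = (if m \<in> B u then wt m u I / (1 - prob I m) else wt m u I)"
proof (cases "m \<in> B u")
  case True
  then have "B u \<inter> {..<Suc m} = insert m (B u \<inter> {..<m})" by (auto simp: less_Suc_eq)
  then show ?thesis using True assms by (simp add: wt_def)
next
  case False
  then have "B u \<inter> {..<Suc m} = B u \<inter> {..<m}" by (auto simp: less_Suc_eq)
  then show ?thesis using False by (simp add: wt_def)
qed

section \<open>Expectation as an iterated conditional expectation\<close>

definition step :: "nat \<Rightarrow> (nat set \<Rightarrow> real) \<Rightarrow> nat set \<Rightarrow> real" where
  "step m F I = prob I m * F (insert m I) + (1 - prob I m) * F I"

text \<open>
  \<open>E m\<close> is the expectation over the set chosen among the vertices below \<open>m\<close>, which lies in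
  \<open>supp m\<close> almost surely.
\<close>

primrec E :: "nat \<Rightarrow> (nat set \<Rightarrow> real) \<Rightarrow> real" where
  "E 0 F = F {}"
| "E (Suc m) F = E m (step m F)"

definition supp :: "nat \<Rightarrow> nat set set" where
  "supp m = {I. I \<subseteq> {..<m} \<and> (\<forall>i\<in>I. B i \<inter> I = {})}"

lemma supp_Suc: "I \<in> supp m \<Longrightarrow> I \<in> supp (Suc m)"
  by (auto simp: supp_def)

lemma supp_not_mem: "I \<in> supp m \<Longrightarrow> m \<le> i \<Longrightarrow> i \<notin> I"
  by (auto simp: supp_def)

text \<open>Once an earlier neighbour of \<open>m\<close> is chosen, a factor of the weight of
  \<open>m\<close> is 0, so \<open>m\<close> has probability 0. In the other direction,
  \<open>m\<close> is an earlier neighbour neither of itself nor of a vertex below it.\<close>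

lemma insert_supp:
  assumes "I \<in> supp m" "prob I m \<noteq> 0"
  shows "insert m I \<in> supp (Suc m)"
proof -
  have "B m \<inter> I = {}"
  proof (rule ccontr)
    assume "B m \<inter> I \<noteq> {}"
    then obtain j where "j \<in> B m" "j \<in> I" by blast
    then have "j \<in> B m \<inter> {..<m}" "j \<in> I" using earlier by auto
    then have "(\<Prod>j\<in>B m \<inter> {..<m}. if j \<in> I then 0 else 1 / (1 - prob I j)) = 0"
      by (intro prod_zero) auto
    then have "wt m m I = 0" by (simp add: wt_def)
    with assms(2) show False by (simp add: prob_eq split: if_splits)
  qed
  moreover have "m \<notin> B i" if "i \<in> insert m I" for i
    using that assms(1) earlier[of i] by (fastforce simp: supp_def)
  ultimately show ?thesis using assms(1) by (auto simp: supp_def)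
qed

text \<open>Comparison on the support suffices because inserting \<open>m\<close> leaves it only
  with probability 0.\<close>

lemma E_mono: "(\<And>I. I \<in> supp m \<Longrightarrow> F I \<le> G I) \<Longrightarrow> E m F \<le> E m G"
proof (induction m arbitrary: F G)
  case (Suc m)
  have "step m F I \<le> step m G I" if I: "I \<in> supp m" for I
  proof -
    have "prob I m * F (insert m I) \<le> prob I m * G (insert m I)"
      using Suc.prems insert_supp[OF I] prob_nonneg[of I m] by (cases "prob I m = 0") (auto intro!: mult_left_mono)
    moreover have "(1 - prob I m) * F I \<le> (1 - prob I m) * G I"
      using Suc.prems supp_Suc[OF I] prob_less_1[of I m] by (auto intro!: mult_left_mono)
    ultimately show ?thesis by (simp add: step_def)
  qed
  then show ?case using Suc.IH by simp
qed (simp add: supp_def)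

lemma E_cong: "(\<And>I. I \<in> supp m \<Longrightarrow> F I = G I) \<Longrightarrow> E m F = E m G"
  by (intro antisym E_mono) auto

lemma E_cmult: "E m (\<lambda>I. c * F I) = c * E m F"
proof (induction m arbitrary: F)
  case (Suc m)
  have "step m (\<lambda>I. c * F I) = (\<lambda>I. c * step m F I)" by (simp add: fun_eq_iff step_def algebra_simps)
  then show ?case using Suc by simp
qed simp

lemma E_add: "E m (\<lambda>I. F I + G I) = E m F + E m G"
proof (induction m arbitrary: F G)
  case (Suc m)
  have "step m (\<lambda>I. F I + G I) = (\<lambda>I. step m F I + step m G I)" by (simp add: fun_eq_iff step_def algebra_simps)
  then show ?case using Suc by simp
qed simp

lemma E_diff: "E m (\<lambda>I. F I - G I) = E m F - E m G"
  using E_add[of m F "\<lambda>I. - 1 * G I"] E_cmult[of m "-1" G] by simp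

lemma E_const: "E m (\<lambda>I. c) = c"
proof (induction m)
  case (Suc m)
  have "step m (\<lambda>I. c) = (\<lambda>I. c)" by (simp add: fun_eq_iff step_def algebra_simps)
  with Suc show ?case by simp
qed simp

lemma E_sum: "E m (\<lambda>I. \<Sum>x\<in>X. F x I) = (\<Sum>x\<in>X. E m (F x))"
  by (induction X rule: infinite_finite_induct) (simp_all add: E_const E_add)

text \<open>The martingale property: the division by \<open>1 - prob I m\<close> on rejection
  compensates exactly for the drop to 0 on choice.\<close>

lemma step_wt:
  assumes "I \<in> supp m"
  shows "step m (wt (Suc m) u) I = wt m u I"
proof -
  have "m \<notin> I" "1 - prob I m \<noteq> 0" using supp_not_mem[OF assms] prob_less_1[of I m] by auto
  then show ?thesis by (simp add: step_def wt_Suc wt_Suc_insert field_simps)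
qed

lemma E_wt: "E m (wt m u) = p"
proof (induction m)
  case (Suc m)
  then show ?case using E_cong[of m "step m (wt (Suc m) u)" "wt m u"] step_wt by simp
qed (simp add: wt_def)

text \<open>\<open>prob I v\<close> is settled by the choices below \<open>v\<close>, so it factors
  out of every later step and the martingale property of the weight of \<open>u\<close>
  applies.\<close>

lemma E_wt_prob_const:
  "E (v + k) (\<lambda>I. wt (v + k) u I * prob I v) = E v (\<lambda>I. wt v u I * prob I v)"
proof (induction k)
  case (Suc k)
  have "step (v + k) (\<lambda>I. wt (Suc (v + k)) u I * prob I v) I = wt (v + k) u I * prob I v"
    if "I \<in> supp (v + k)" for I
  proof -
    have "step (v + k) (\<lambda>I. wt (Suc (v + k)) u I * prob I v) I = step (v + k) (wt (Suc (v + k)) u) I * prob I v"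
      by (simp add: step_def prob_insert algebra_simps)
    with step_wt[OF that] show ?thesis by simp
  qed
  then have "E (Suc (v + k)) (\<lambda>I. wt (Suc (v + k)) u I * prob I v) = E (v + k) (\<lambda>I. wt (v + k) u I * prob I v)"
    by (auto intro: E_cong)
  with Suc show ?case by simp
qed simp

text \<open>Only a common earlier neighbour of \<open>u\<close> and \<open>v\<close> correlates the two weights.\<close>

lemma E_wt_mult_wt_le:
  "E m (\<lambda>I. wt m u I * wt m v I) \<le> p\<^sup>2 * (1 / (1 - \<tau>)) ^ card (B u \<inter> B v \<inter> {..<m})"
proof (induction m)
  case (Suc m)
  define c where "c = (if m \<in> B u \<inter> B v then 1 / (1 - \<tau>) else 1)"
  have c0: "0 \<le> c" using tau_less_1 by (simp add: c_def)
  have cancel: "r * (a / r * (b / r)) = a * b / r" if "r \<noteq> 0" for a b r :: real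
    using that by simp
  have "step m (\<lambda>I. wt (Suc m) u I * wt (Suc m) v I) I \<le> c * (wt m u I * wt m v I)"
    if I: "I \<in> supp m" for I
  proof -
    have m: "m \<notin> I" using I by (auto simp: supp_def)
    have r: "0 < 1 - prob I m" using prob_less_1[of I m] by simp
    have r': "1 / (1 - prob I m) \<le> 1 / (1 - \<tau>)"
      using prob_le_tau[of I m] tau_less_1 by (intro divide_left_mono) auto
    show ?thesis
    proof (cases "m \<in> B u \<inter> B v")
      case True
      \<comment> \<open>Rejection has probability \<open>1 - prob I m\<close> and divides both
        weights by it, which leaves one such factor uncancelled.\<close>
      then have "step m (\<lambda>I. wt (Suc m) u I * wt (Suc m) v I) I = 1 / (1 - prob I m) * (wt m u I * wt m v I)"
        using cancel[of "1 - prob I m" "wt m u I" "wt m v I"] r by (simp add: step_def wt_Suc[OF m] wt_Suc_insert)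
      also have "\<dots> \<le> c * (wt m u I * wt m v I)"
        using True r' wt_nonneg by (intro mult_right_mono) (auto simp: c_def)
      finally show ?thesis .
    next
      case False
      then show ?thesis
        using r by (auto simp: c_def step_def wt_Suc[OF m] wt_Suc_insert field_simps)
    qed
  qed
  then have "E (Suc m) (\<lambda>I. wt (Suc m) u I * wt (Suc m) v I) \<le> c * E m (\<lambda>I. wt m u I * wt m v I)"
    using E_mono[of m _ "\<lambda>I. c * (wt m u I * wt m v I)"] by (simp add: E_cmult)
  also have "\<dots> \<le> c * (p\<^sup>2 * (1 / (1 - \<tau>)) ^ card (B u \<inter> B v \<inter> {..<m}))"
    by (rule mult_left_mono[OF Suc c0])
  also have "\<dots> = p\<^sup>2 * (1 / (1 - \<tau>)) ^ card (B u \<inter> B v \<inter> {..<Suc m})"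
  proof (cases "m \<in> B u \<inter> B v")
    case True
    then have "B u \<inter> B v \<inter> {..<Suc m} = insert m (B u \<inter> B v \<inter> {..<m})" by (auto simp: less_Suc_eq)
    then show ?thesis using True by (simp add: c_def)
  next
    case False
    then have "B u \<inter> B v \<inter> {..<Suc m} = B u \<inter> B v \<inter> {..<m}" by (auto simp: less_Suc_eq)
    moreover have "c = 1" unfolding c_def using False by (rule if_not_P)
    ultimately show ?thesis by simp
  qed
  finally show ?case .
qed (simp add: wt_def power2_eq_square)

text \<open>By \<open>E_wt_prob_const\<close> the expectation may be taken at time \<open>v\<close>.
  There \<open>prob I v\<close> is bounded by the weight of \<open>v\<close> in the first estimate
  and by \<open>\<tau>\<close> in the second.\<close>

lemma E_wt_prob_le:
  assumes "v \<in> B u"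
  shows "E u (\<lambda>I. wt u u I * prob I v) \<le> p\<^sup>2 * (1 / (1 - \<tau>)) ^ card (B u \<inter> B v)"
    and "E u (\<lambda>I. wt u u I * prob I v) \<le> p * \<tau>"
proof -
  have vu: "v < u" using assms earlier by auto
  then have eq: "E u (\<lambda>I. wt u u I * prob I v) = E v (\<lambda>I. wt v u I * prob I v)"
    using E_wt_prob_const[of v "u - v" u] by simp
  have "E v (\<lambda>I. wt v u I * prob I v) \<le> E v (\<lambda>I. wt v u I * wt v v I)"
    by (intro E_mono mult_left_mono prob_le_wt wt_nonneg)
  also have "\<dots> \<le> p\<^sup>2 * (1 / (1 - \<tau>)) ^ card (B u \<inter> B v \<inter> {..<v})" by (rule E_wt_mult_wt_le)
  also have "B u \<inter> B v \<inter> {..<v} = B u \<inter> B v" using earlier by blast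
  finally show "E u (\<lambda>I. wt u u I * prob I v) \<le> p\<^sup>2 * (1 / (1 - \<tau>)) ^ card (B u \<inter> B v)"
    by (simp add: eq)
  have "E v (\<lambda>I. wt v u I * prob I v) \<le> E v (\<lambda>I. \<tau> * wt v u I)"
    using mult_left_mono[OF prob_le_tau wt_nonneg] by (intro E_mono) (simp add: mult.commute)
  also have "\<dots> = p * \<tau>" by (simp add: E_cmult E_wt)
  finally show "E u (\<lambda>I. wt u u I * prob I v) \<le> p * \<tau>" by (simp only: eq)
qed

section \<open>The part of a weight above the threshold \<open>\<tau>\<close>\<close>

lemma inverse_one_minus_le_exp:
  assumes "0 \<le> x" "x \<le> \<tau>"
  shows "1 / (1 - x) \<le> exp (x / (1 - \<tau>))"
proof -
  have "1 / (1 - x) = 1 + x / (1 - x)" using assms tau_less_1 by (simp add: field_simps)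
  also have "\<dots> \<le> 1 + x / (1 - \<tau>)" using assms tau_less_1 by (intro add_left_mono divide_left_mono) auto
  also have "\<dots> \<le> exp (x / (1 - \<tau>))" by (rule exp_ge_add_one_self)
  finally show ?thesis .
qed

lemma wt_le_exp: "wt u u I \<le> p * exp ((\<Sum>v\<in>B u. prob I v) / (1 - \<tau>))"
proof -
  have fin: "finite (B u)" using earlier[of u] finite_subset by blast
  have "(\<Prod>j\<in>B u \<inter> {..<u}. if j \<in> I then 0 else 1 / (1 - prob I j)) \<le> (\<Prod>j\<in>B u. exp (prob I j / (1 - \<tau>)))"
    using earlier[of u] less_imp_le[OF prob_less_1] inverse_one_minus_le_exp[OF prob_nonneg prob_le_tau]
    by (subst Int_absorb2) (auto intro!: prod_mono)
  also have "\<dots> = exp ((\<Sum>v\<in>B u. prob I v) / (1 - \<tau>))"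
    by (simp add: exp_sum[OF fin] sum_divide_distrib)
  finally show ?thesis unfolding wt_def using p_pos by simp
qed

text \<open>Markov's inequality in pointwise form. For a weight above \<open>\<tau>\<close>,
  \<open>wt_le_exp\<close> forces the sum of probabilities up to
  \<open>(1 - \<tau>) * ln (\<tau> / p)\<close>, so the right side is at least the weight; otherwise
  the left side is 0.\<close>

lemma wt_exceeds_tau_le:
  assumes "p < \<tau>"
  shows "wt u u I - prob I u \<le> wt u u I * (\<Sum>v\<in>B u. prob I v) / ((1 - \<tau>) * ln (\<tau> / p))"
proof (cases "wt u u I \<le> \<tau>")
  case True
  have "0 \<le> (\<Sum>v\<in>B u. prob I v)" by (intro sum_nonneg prob_nonneg)
  with True show ?thesis
    using wt_nonneg[of u u I] assms p_pos tau_less_1 by (simp add: prob_eq)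
next
  case False
  let ?s = "\<Sum>v\<in>B u. prob I v"
  have pos: "0 < (1 - \<tau>) * ln (\<tau> / p)" using assms p_pos tau_less_1 by simp
  have "\<tau> < p * exp (?s / (1 - \<tau>))" using False wt_le_exp[of u I] by simp
  then have "\<tau> / p < exp (?s / (1 - \<tau>))" using p_pos by (simp add: field_simps)
  then have "ln (\<tau> / p) < ?s / (1 - \<tau>)"
    using tau_pos p_pos by (metis exp_less_cancel_iff exp_ln divide_pos_pos)
  then have "(1 - \<tau>) * ln (\<tau> / p) \<le> ?s" using tau_less_1 by (simp add: field_simps)
  then have "wt u u I * 1 \<le> wt u u I * (?s / ((1 - \<tau>) * ln (\<tau> / p)))"
    using pos by (intro mult_left_mono wt_nonneg) (simp add: field_simps)
  with False show ?thesis by (simp add: prob_eq)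
qed

text \<open>
  The first bound of \<open>E_wt_prob_le\<close> is used for the \<open>v\<close> with at most \<open>k\<^sub>0\<close> neighbours in \<open>B u\<close>, the
  second one for the others, of which there are at most \<open>s / k\<^sub>0\<close>.
\<close>

lemma E_prob_ge:
  fixes d s k\<^sub>0 :: real
  assumes "p < \<tau>" and k0: "0 < k\<^sub>0"
    and deg: "real (card (B u)) \<le> d"
    and sparse: "real (\<Sum>v\<in>B u. card (B u \<inter> B v)) \<le> s"
  shows "E u (\<lambda>I. prob I u) \<ge>
    p * (1 - (d * p * exp (k\<^sub>0 * \<tau> / (1 - \<tau>)) + \<tau> * s / k\<^sub>0) / ((1 - \<tau>) * ln (\<tau> / p)))"
proof -
  let ?b = "(1 - \<tau>) * ln (\<tau> / p)" and ?x = "exp (k\<^sub>0 * \<tau> / (1 - \<tau>))"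
  have fin: "finite (B u)" using earlier[of u] finite_subset by blast
  have b: "0 < ?b" using assms p_pos tau_less_1 by simp
  \<comment> \<open>Adding both bounds avoids splitting the sum over \<open>B u\<close>; where the
    second is needed, \<open>card (B u \<inter> B v) / k\<^sub>0\<close> exceeds 1.\<close>
  have summand: "E u (\<lambda>I. wt u u I * prob I v) \<le> p * (p * ?x) + p * (\<tau> * (real (card (B u \<inter> B v)) / k\<^sub>0))"
    if v: "v \<in> B u" for v
  proof (cases "real (card (B u \<inter> B v)) \<le> k\<^sub>0")
    case True
    have "(1 / (1 - \<tau>)) ^ card (B u \<inter> B v) \<le> exp (\<tau> / (1 - \<tau>)) ^ card (B u \<inter> B v)"
      using inverse_one_minus_le_exp[of \<tau>] tau_pos tau_less_1 by (intro power_mono) auto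
    also have "\<dots> = exp (real (card (B u \<inter> B v)) * (\<tau> / (1 - \<tau>)))" by (simp only: exp_of_nat_mult)
    also have "\<dots> \<le> exp (k\<^sub>0 * (\<tau> / (1 - \<tau>)))"
      using True tau_pos tau_less_1 by (simp add: divide_right_mono mult_right_mono)
    finally have "p\<^sup>2 * (1 / (1 - \<tau>)) ^ card (B u \<inter> B v) \<le> p * (p * ?x)"
      using p_pos by (simp add: power2_eq_square)
    with E_wt_prob_le(1)[OF v] have "E u (\<lambda>I. wt u u I * prob I v) \<le> p * (p * ?x)" by linarith
    moreover have "0 \<le> p * (\<tau> * (real (card (B u \<inter> B v)) / k\<^sub>0))" using p_pos tau_pos k0 by simp
    ultimately show ?thesis by linarith
  next
    case False
    then have "p * (\<tau> * 1) \<le> p * (\<tau> * (real (card (B u \<inter> B v)) / k\<^sub>0))"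
      using p_pos tau_pos k0 by (intro mult_left_mono) (auto simp: field_simps)
    moreover have "0 \<le> p * (p * ?x)" using p_pos by simp
    ultimately show ?thesis using E_wt_prob_le(2)[OF v] by simp
  qed
  have "E u (\<lambda>I. wt u u I * (\<Sum>v\<in>B u. prob I v)) = (\<Sum>v\<in>B u. E u (\<lambda>I. wt u u I * prob I v))"
    by (simp add: sum_distrib_left E_sum)
  also have "\<dots> \<le> (\<Sum>v\<in>B u. p * (p * ?x) + p * (\<tau> * (real (card (B u \<inter> B v)) / k\<^sub>0)))"
    by (intro sum_mono summand)
  also have "\<dots> = p * (real (card (B u)) * (p * ?x) + \<tau> * (real (\<Sum>v\<in>B u. card (B u \<inter> B v)) / k\<^sub>0))"
    by (simp add: sum.distrib sum_distrib_left sum_divide_distrib algebra_simps)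
  also have "\<dots> \<le> p * (d * (p * ?x) + \<tau> * (s / k\<^sub>0))"
    using p_pos tau_pos k0 deg sparse by (intro mult_left_mono add_mono mult_right_mono divide_right_mono) auto
  finally have S: "E u (\<lambda>I. wt u u I * (\<Sum>v\<in>B u. prob I v)) \<le> p * (d * p * ?x + \<tau> * s / k\<^sub>0)"
    by (simp add: mult_ac)
  have "E u (wt u u) - E u (\<lambda>I. prob I u) = E u (\<lambda>I. wt u u I - prob I u)" by (simp add: E_diff)
  also have "\<dots> \<le> E u (\<lambda>I. 1 / ?b * (wt u u I * (\<Sum>v\<in>B u. prob I v)))"
    using wt_exceeds_tau_le[OF assms(1)] by (intro E_mono) simp
  also have "\<dots> = 1 / ?b * E u (\<lambda>I. wt u u I * (\<Sum>v\<in>B u. prob I v))" by (rule E_cmult)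
  also have "\<dots> \<le> 1 / ?b * (p * (d * p * ?x + \<tau> * s / k\<^sub>0))"
    using b S by (intro mult_left_mono) auto
  finally show ?thesis by (simp add: E_wt algebra_simps diff_divide_distrib add_divide_distrib)
qed

subsection \<open>Concentration\<close>

text \<open>Measurability of \<open>F\<close> with respect to the choices inside
  \<open>A\<close>.\<close>

definition depends :: "nat \<Rightarrow> (nat set \<Rightarrow> real) \<Rightarrow> nat set \<Rightarrow> bool" where
  "depends m F A \<longleftrightarrow> (\<forall>I\<subseteq>{..<m}. F (I \<inter> A) = F I)"

lemma dependsD:
  assumes "depends (Suc m) F A" "I \<subseteq> {..<m}"
  shows "F (I \<inter> A) = F I" "F (insert m I \<inter> A) = F (insert m I)"
proof -
  have "I \<subseteq> {..<Suc m}" "insert m I \<subseteq> {..<Suc m}" using assms(2) by auto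
  then show "F (I \<inter> A) = F I" "F (insert m I \<inter> A) = F (insert m I)"
    using assms(1) by (simp_all only: depends_def)
qed

lemma depends_not_mem:
  assumes "depends (Suc m) F A" "m \<notin> A" "I \<subseteq> {..<m}"
  shows "F (insert m I) = F I"
proof -
  have "F (insert m I \<inter> A) = F (insert m I)" "F (I \<inter> A) = F I"
    using dependsD[OF assms(1,3)] by simp_all
  moreover have "insert m I \<inter> A = I \<inter> A" using assms(2) by blast
  ultimately show ?thesis by simp
qed

lemma step_depends_not_mem:
  assumes "depends (Suc m) F A" "m \<notin> A" "I \<subseteq> {..<m}"
  shows "step m F I = F I"
  using depends_not_mem[OF assms] by (simp add: step_def algebra_simps)

text \<open>As the largest vertex in \<open>A\<close>, \<open>m\<close> is an earlier neighbour of
  no member, so removing it keeps closure. Averaging over \<open>m\<close> uses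
  \<open>prob I m\<close>, which by \<open>prob_cong\<close> is determined by the choices in
  \<open>A - {m}\<close>.\<close>

lemma depends_step:
  assumes F: "depends (Suc m) F A" and A: "back_closed A" "A \<subseteq> {..<Suc m}" "m \<in> A"
  shows "depends m (step m F) (A - {m})" "back_closed (A - {m})"
proof -
  show closed: "back_closed (A - {m})"
    unfolding back_closed_def
  proof (intro ballI subsetI)
    fix x y assume "x \<in> A - {m}" "y \<in> B x"
    then have "y \<in> A" "y < x" "x < Suc m" using A earlier[of x] by (auto simp: back_closed_def)
    then show "y \<in> A - {m}" by simp
  qed
  have Bm: "B m \<subseteq> A - {m}" using A earlier[of m] by (auto simp: back_closed_def)
  show "depends m (step m F) (A - {m})"
    unfolding depends_def
  proof (intro allI impI)
    fix I assume I: "I \<subseteq> {..<m}"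
    then have "I \<inter> (A - {m}) = I \<inter> A" by auto
    moreover have "prob (I \<inter> (A - {m})) m = prob I m"
      by (rule prob_cong[OF closed Bm]) auto
    moreover have "F (I \<inter> A) = F I" by (rule dependsD[OF F I])
    moreover have "F (insert m (I \<inter> A)) = F (insert m I)"
    proof -
      have "F (insert m I \<inter> A) = F (insert m I)" by (rule dependsD[OF F I])
      moreover have "insert m I \<inter> A = insert m (I \<inter> A)" using A(3) by blast
      ultimately show ?thesis by simp
    qed
    ultimately show "step m F (I \<inter> (A - {m})) = step m F I" by (simp add: step_def)
  qed
qed

lemma depends_Suc: "depends (Suc m) F A \<Longrightarrow> depends m F A"
  by (auto simp: depends_def[of m] dependsD)

lemma supp_subset: "I \<in> supp m \<Longrightarrow> I \<subseteq> {..<m}"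
  by (simp add: supp_def)

text \<open>Induct on \<open>m\<close>: the last vertex belongs to at most one of the disjoint
  closed sets, and integrating it out changes only that factor.\<close>

lemma E_indep:
  assumes "back_closed A" "back_closed A'" "A \<inter> A' = {}" "A \<subseteq> {..<m}" "A' \<subseteq> {..<m}"
    and "depends m F A" "depends m G A'"
  shows "E m (\<lambda>I. F I * G I) = E m F * E m G"
  using assms
proof (induction m arbitrary: F G A A')
  case (Suc m)
  have one: "E (Suc m) (\<lambda>I. F I * G I) = E (Suc m) F * E (Suc m) G"
    if A: "back_closed A" "back_closed A'" "A \<inter> A' = {}" "A \<subseteq> {..<Suc m}" "A' \<subseteq> {..<Suc m}"
      "depends (Suc m) F A" "depends (Suc m) G A'" and m: "m \<in> A"
    for F G A A'
  proof -
    have m': "m \<notin> A'" using A(3) m by blast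
    have "E (Suc m) (\<lambda>I. F I * G I) = E m (\<lambda>I. step m F I * G I)"
      using depends_not_mem[OF A(7) m'] supp_subset by (auto intro!: E_cong simp: step_def algebra_simps)
    also have "\<dots> = E m (step m F) * E m G"
      using A m m' depends_step[OF A(6,1,4) m] depends_Suc[OF A(7)]
      by (intro Suc.IH[of "A - {m}" A']) (auto simp: less_Suc_eq)
    also have "E m G = E (Suc m) G"
      using step_depends_not_mem[OF A(7) m'] supp_subset by (auto intro!: E_cong)
    finally show ?thesis by simp
  qed
  consider "m \<in> A" | "m \<in> A'" | "m \<notin> A" "m \<notin> A'" by blast
  then show ?case
  proof cases
    case 1
    then show ?thesis using one Suc.prems by blast
  next
    case 2
    then have "E (Suc m) (\<lambda>I. G I * F I) = E (Suc m) G * E (Suc m) F"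
      using one[of A' A G F] Suc.prems by blast
    then show ?thesis by (simp add: mult.commute)
  next
    case 3
    have "E (Suc m) (\<lambda>I. F I * G I) = E m (\<lambda>I. F I * G I)"
      using depends_not_mem[OF Suc.prems(6) 3(1)] depends_not_mem[OF Suc.prems(7) 3(2)] supp_subset
      by (auto intro!: E_cong simp: step_def algebra_simps)
    also have "\<dots> = E m F * E m G"
      using Suc.prems 3 depends_Suc by (intro Suc.IH[of A A']) (auto simp: less_Suc_eq)
    also have "E m F = E (Suc m) F"
      using step_depends_not_mem[OF Suc.prems(6) 3(1)] supp_subset by (auto intro!: E_cong)
    also have "E m G = E (Suc m) G"
      using step_depends_not_mem[OF Suc.prems(7) 3(2)] supp_subset by (auto intro!: E_cong)
    finally show ?thesis .
  qed
qed simp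

section \<open>Ancestors and uncorrelated vertices\<close>

lemma E_mem: "u < m \<Longrightarrow> E m (\<lambda>I. of_bool (u \<in> I)) = E u (\<lambda>I. prob I u)"
proof (induction m)
  case (Suc m)
  show ?case
  proof (cases "u = m")
    case True
    then show ?thesis using supp_not_mem by (auto intro!: E_cong simp: step_def)
  next
    case False
    then have "step m (\<lambda>I. of_bool (u \<in> I)) = (\<lambda>I. of_bool (u \<in> I))"
      by (auto simp: fun_eq_iff step_def)
    with False Suc show ?thesis by simp
  qed
qed simp

text \<open>The least back-closed set containing \<open>u\<close>; it carries the whole history on
  which the choice of \<open>u\<close> depends.\<close>

definition ancestors :: "nat \<Rightarrow> nat set" where
  "ancestors u = {x. (x, u) \<in> {(j, i). j \<in> B i}\<^sup>*}"

lemma back_closed_ancestors: "back_closed (ancestors u)"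
  by (auto simp: back_closed_def ancestors_def intro: converse_rtrancl_into_rtrancl)

lemma ancestors_self: "u \<in> ancestors u"
  by (simp add: ancestors_def)

lemma ancestors_le:
  assumes "x \<in> ancestors u"
  shows "x \<le> u"
proof -
  have "(x, u) \<in> {(j, i). j \<in> B i}\<^sup>*" using assms by (simp add: ancestors_def)
  then show ?thesis
  proof induction
    case (step y z)
    then show ?case using earlier[of z] by force
  qed simp
qed

lemma E_mem_indep:
  assumes "u < m" "v < m" "ancestors u \<inter> ancestors v = {}"
  shows "E m (\<lambda>I. of_bool (u \<in> I) * of_bool (v \<in> I))
    = E u (\<lambda>I. prob I u) * E v (\<lambda>I. prob I v)"
proof -
  have "E m (\<lambda>I. of_bool (u \<in> I) * of_bool (v \<in> I))
      = E m (\<lambda>I. of_bool (u \<in> I)) * E m (\<lambda>I. of_bool (v \<in> I))"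
    using assms ancestors_le ancestors_self
    by (intro E_indep[OF back_closed_ancestors back_closed_ancestors assms(3)])
      (fastforce simp: depends_def)+
  then show ?thesis using assms by (simp add: E_mem)
qed

text \<open>
  Ancestors lie in strictly smaller columns, so vertices with a common ancestor are joined by a walk of
  \<open>2 n\<close> steps in \<open>R\<close>; all other pairs are uncorrelated.
\<close>

lemma exists_balanced:
  fixes R :: "(nat \<times> nat) set" and col :: "nat \<Rightarrow> nat" and N n q D :: nat and \<rho> \<delta> :: real
  defines "C \<equiv> \<lambda>c. {i. i < N \<and> col i = c}"
  assumes R: "\<And>i j. j \<in> B i \<Longrightarrow> (i, j) \<in> R \<and> (j, i) \<in> R" and Id: "Id \<subseteq> R"
    and deg: "\<And>x. finite (R `` {x})" "\<And>x. card (R `` {x}) \<le> D"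
    and col: "\<And>i j. j \<in> B i \<Longrightarrow> col j < col i" "\<And>i. i < N \<Longrightarrow> col i < n"
    and cardC: "\<And>c. card (C c) \<le> q"
    and \<rho>: "\<And>u. u < N \<Longrightarrow> \<rho> \<le> E u (\<lambda>I. prob I u)"
    and \<delta>: "0 < \<delta>" and q: "real (n * D ^ (2 * n)) < \<delta>\<^sup>2 * real q"
  shows "\<exists>I\<in>supp N. \<forall>c<n. \<rho> * card (C c) - \<delta> * q \<le> card (I \<inter> C c)"
proof -
  define \<pi> where "\<pi> u = E u (\<lambda>I. prob I u)" for u
  define Z where "Z c I = (\<Sum>u\<in>C c. of_bool (u \<in> I) - \<pi> u)" for c I
  have finC: "finite (C c)" for c by (simp add: C_def)
  have R_mono: "R ^^ k \<subseteq> R ^^ (k + j)" for k j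
    using Id by (induction j) (auto intro: relcompI)
  have path: "(x, u) \<in> R ^^ k \<and> (u, x) \<in> R ^^ k \<and> col x + k \<le> col u"
    if "(x, u) \<in> {(j, i). j \<in> B i} ^^ k" for x u k
    using that
  proof (induction k arbitrary: u)
    case (Suc k)
    then obtain y where y: "(x, y) \<in> {(j, i). j \<in> B i} ^^ k" "y \<in> B u" by auto
    from Suc.IH[OF y(1)] R[OF y(2)] col(1)[OF y(2)] show ?case
      using relpow_Suc_I[of x y k R u] relpow_Suc_I2[of u y R x k] by auto
  qed simp
  have anc: "(x, u) \<in> R ^^ n \<and> (u, x) \<in> R ^^ n" if "x \<in> ancestors u" "u < N" for x u
  proof -
    have "(x, u) \<in> {(j, i). j \<in> B i}\<^sup>*" using that(1) by (simp only: ancestors_def mem_Collect_eq)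
    from rtrancl_imp_relpow[OF this] obtain k where k: "(x, u) \<in> {(j, i). j \<in> B i} ^^ k" ..
    \<comment> \<open>Columns strictly increase along the chain, so its length is at most
      \<open>n\<close>; \<open>Id \<subseteq> R\<close> pads it to exactly \<open>n\<close>
      steps.\<close>
    have "k \<le> n" using path[OF k] col(2)[OF that(2)] by linarith
    then show ?thesis using path[OF k] R_mono[of k "n - k"] by auto
  qed
  have cov: "E N (\<lambda>I. of_bool (u \<in> I) * of_bool (v \<in> I)) - \<pi> u * \<pi> v \<le> of_bool (v \<in> (R ^^ (2 * n)) `` {u})"
    if "u < N" "v < N" for u v
  proof (cases "ancestors u \<inter> ancestors v = {}")
    case True
    then show ?thesis using that by (simp add: E_mem_indep \<pi>_def)
  next
    case False
    then obtain x where "x \<in> ancestors u" "x \<in> ancestors v" by blast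
    then have "(u, v) \<in> R ^^ (n + n)" using anc that unfolding relpow_add by blast
    moreover have "E N (\<lambda>I. of_bool (u \<in> I) * of_bool (v \<in> I)) \<le> E N (\<lambda>I. 1)"
      by (intro E_mono) auto
    moreover have "E w (\<lambda>I. 0) \<le> \<pi> w" for w
      unfolding \<pi>_def by (intro E_mono prob_nonneg)
    then have "0 \<le> \<pi> u * \<pi> v" by (simp add: E_const)
    ultimately show ?thesis by (simp add: E_const mult_2)
  qed
  \<comment> \<open>A vertex has positive covariance with at most \<open>D ^ (2 * n)\<close>
    vertices, so the variance grows only linearly in \<open>q\<close>.\<close>
  have var: "E N (\<lambda>I. (Z c I)\<^sup>2) \<le> real (q * D ^ (2 * n))" for c
  proof -
    have "E N (\<lambda>I. (of_bool (u \<in> I) - \<pi> u) * (of_bool (v \<in> I) - \<pi> v))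
        = E N (\<lambda>I. of_bool (u \<in> I) * of_bool (v \<in> I)) - \<pi> u * \<pi> v"
      if "u < N" "v < N" for u v
    proof -
      have "E N (\<lambda>I. (of_bool (u \<in> I) - \<pi> u) * (of_bool (v \<in> I) - \<pi> v))
          = E N (\<lambda>I. (of_bool (u \<in> I) * of_bool (v \<in> I) + \<pi> u * \<pi> v)
              - (\<pi> u * of_bool (v \<in> I) + \<pi> v * of_bool (u \<in> I)))"
        by (simp add: algebra_simps)
      also have "\<dots> = E N (\<lambda>I. of_bool (u \<in> I) * of_bool (v \<in> I)) + \<pi> u * \<pi> v - (\<pi> u * \<pi> v + \<pi> v * \<pi> u)"
        using that by (simp only: E_diff E_add E_cmult E_const E_mem \<pi>_def)
      finally show ?thesis by simp
    qed
    note pair = this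
    have "E N (\<lambda>I. (Z c I)\<^sup>2)
        = (\<Sum>u\<in>C c. \<Sum>v\<in>C c. E N (\<lambda>I. (of_bool (u \<in> I) - \<pi> u) * (of_bool (v \<in> I) - \<pi> v)))"
      by (simp add: Z_def power2_eq_square sum_product E_sum)
    also have "\<dots> \<le> (\<Sum>u\<in>C c. \<Sum>v\<in>C c. of_bool (v \<in> (R ^^ (2 * n)) `` {u}))"
      using pair cov by (intro sum_mono) (auto simp: C_def)
    also have "\<dots> \<le> (\<Sum>u\<in>C c. real (D ^ (2 * n)))"
    proof (rule sum_mono)
      fix u
      have "(\<Sum>v\<in>C c. of_bool (v \<in> (R ^^ (2 * n)) `` {u})) = real (card (C c \<inter> (R ^^ (2 * n)) `` {u}))"
        using finC by (simp add: of_bool_def sum.If_cases Image_singleton)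
      also have "\<dots> \<le> real (D ^ (2 * n))"
        using card_relpow_Image_le[of R D "2 * n" u] deg card_mono[of "(R ^^ (2 * n)) `` {u}" "C c \<inter> (R ^^ (2 * n)) `` {u}"]
        by (intro of_nat_mono) (meson Int_lower2 order_trans)
      finally show "(\<Sum>v\<in>C c. of_bool (v \<in> (R ^^ (2 * n)) `` {u})) \<le> real (D ^ (2 * n))" .
    qed
    also have "\<dots> = real (card (C c) * D ^ (2 * n))" by simp
    also have "\<dots> \<le> real (q * D ^ (2 * n))" using cardC by (intro of_nat_mono mult_right_mono) auto
    finally show ?thesis .
  qed
  \<comment> \<open>Averaging: by the assumption on \<open>q\<close> the mean of this sum is below
    \<open>(\<delta> * q)\<^sup>2\<close>, and bounding the sum controls all columns in one
    outcome.\<close>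
  have "\<exists>I\<in>supp N. (\<Sum>c<n. (Z c I)\<^sup>2) < (\<delta> * q)\<^sup>2"
  proof (rule ccontr)
    assume "\<not> ?thesis"
    then have "E N (\<lambda>I. (\<delta> * q)\<^sup>2) \<le> E N (\<lambda>I. \<Sum>c<n. (Z c I)\<^sup>2)"
      by (intro E_mono) (auto simp: not_less)
    also have "\<dots> = (\<Sum>c<n. E N (\<lambda>I. (Z c I)\<^sup>2))" by (rule E_sum)
    also have "\<dots> \<le> (\<Sum>c<n. real (q * D ^ (2 * n)))" by (intro sum_mono var)
    also have "\<dots> = q * real (n * D ^ (2 * n))" by simp
    finally have "\<delta>\<^sup>2 * q * q \<le> real (n * D ^ (2 * n)) * q"
      by (simp add: E_const power2_eq_square mult_ac)
    moreover have "0 < q" using q by (rule pos_if_less_mult)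
    ultimately show False using q by (simp del: of_nat_mult of_nat_power)
  qed
  then obtain I where I: "I \<in> supp N" "(\<Sum>c<n. (Z c I)\<^sup>2) < (\<delta> * q)\<^sup>2" by blast
  have "\<rho> * card (C c) - \<delta> * q \<le> card (I \<inter> C c)" if "c < n" for c
  proof -
    have "(Z c I)\<^sup>2 \<le> (\<Sum>c<n. (Z c I)\<^sup>2)" using that by (intro member_le_sum) auto
    also note I(2)
    finally have "\<bar>Z c I\<bar>\<^sup>2 < (\<delta> * q)\<^sup>2" by (simp only: power2_abs)
    then have "\<bar>Z c I\<bar> < \<delta> * q" by (rule power2_less_imp_less) (use \<delta> in simp)
    moreover have "Z c I = card (I \<inter> C c) - (\<Sum>u\<in>C c. \<pi> u)"
      using finC by (simp add: Z_def sum_subtractf of_bool_def sum.If_cases Int_commute[of I])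
    moreover have "(\<Sum>u\<in>C c. \<rho>) \<le> (\<Sum>u\<in>C c. \<pi> u)"
      using \<rho> by (intro sum_mono) (auto simp: \<pi>_def C_def)
    ultimately show ?thesis by (simp add: mult.commute)
  qed
  with I(1) show ?thesis by blast
qed

end

subsection \<open>Covers\<close>

lemma edge_set_restrict:
  fixes K :: "'a pair_pre_digraph"
  shows "edge_set (K \<restriction> A) = {{u, v} | u v. u \<in> A \<and> v \<in> A \<and> u \<rightarrow>\<^bsub>K\<^esub> v}"
  by (auto simp: edge_set_def arcs_ends_conv)

text \<open>The process runs on the numbered vertices of \<open>H\<close>. By the matching condition
  the earlier neighbours of such a vertex lie in distinct lists, so they map injectively to
  back-neighbours in \<open>G\<close>, and the degree and sparsity bounds carry over. The deviation
  allowed by \<open>exists_balanced\<close> costs \<open>\<delta>\<close>.\<close>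

lemma frac_coloring_exists:
  fixes G :: "'a pair_pre_digraph" and vs :: "'a list" and L :: "'a \<Rightarrow> 'b set" and H :: "'b pair_pre_digraph"
    and d q :: nat and s p \<tau> k\<^sub>0 \<delta> \<rho> :: real
  defines "n \<equiv> length vs"
  assumes order: "degeneracy_ordering d G vs"
    and sparse: "\<And>i. i < n \<Longrightarrow> real (card (edge_set (G \<restriction> back_nbrs G vs i))) \<le> s"
    and cover: "DP_cover G L H" and fold: "q_fold G q L"
    and params: "0 < p" "p < \<tau>" "\<tau> < 1" "0 < k\<^sub>0"
    and \<rho>: "\<rho> \<le> p * (1 - (real d * p * exp (k\<^sub>0 * \<tau> / (1 - \<tau>)) + \<tau> * s / k\<^sub>0) / ((1 - \<tau>) * ln (\<tau> / p)))"
    and \<delta>: "0 < \<delta>" and q: "real (n * (n + 1) ^ (2 * n)) < \<delta>\<^sup>2 * real q"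
  shows "\<exists>S. frac_coloring G (\<rho> - \<delta>) L H S"
proof -
  interpret H: pair_graph H using cover by (simp add: DP_cover_def)
  have vs: "distinct vs" "set vs = pverts G"
    using order by (auto simp: degeneracy_ordering_def vertex_ordering_def)
  have vsG: "vs ! c \<in> pverts G" if "c < n" for c
    using nth_mem[of c vs] that unfolding n_def vs(2) .
  have vs_eq: "vs ! c = vs ! c' \<longleftrightarrow> c = c'" if "c < n" "c' < n" for c c'
    using vs that by (simp add: n_def nth_eq_iff_index_eq)
  have q0: "0 < q" using q by (rule pos_if_less_mult)
  have "\<exists>f. bij_betw f {..<q} (L (vs ! c))" if "c < n" for c
  proof -
    have cardL: "card (L (vs ! c)) = q" using fold vsG[OF that] by (simp add: q_fold_def)
    then have "finite (L (vs ! c))" using q0 by (metis card.infinite less_irrefl)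
    from ex_bij_betw_nat_finite[OF this] cardL show ?thesis by (simp add: atLeast0LessThan)
  qed
  then obtain e where e: "\<And>c. c < n \<Longrightarrow> bij_betw (e c) {..<q} (L (vs ! c))" by metis
  define N where "N = n * q"
  \<comment> \<open>Number the vertices of \<open>H\<close> so that the list of the \<open>c\<close>-th vertex of \<open>G\<close> becomes \<open>{c * q..<(c + 1) * q}\<close>.\<close>
  define h where "h m = e (m div q) (m mod q)" for m
  define C where "C c = {m. m < N \<and> m div q = c}" for c
  have div_n: "m div q < n" if "m < N" for m
    using that by (simp add: N_def less_mult_imp_div_less)
  have hL: "h m \<in> L (vs ! (m div q))" if "m < N" for m
    using e[OF div_n[OF that]] q0 unfolding h_def bij_betw_def by auto
  have LH: "L (vs ! c) \<subseteq> pverts H" if "c < n" for c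
    using cover vsG[OF that] by (auto simp: DP_cover_def)
  have hH: "h m \<in> pverts H" if "m < N" for m using hL[OF that] LH[OF div_n[OF that]] by blast
  have disj: "L (vs ! c) \<inter> L (vs ! c') = {}" if "c < n" "c' < n" "c \<noteq> c'" for c c'
    using cover vsG that vs_eq by (auto simp: DP_cover_def disjoint_family_on_def)
  have h_inj: "m = m'" if "m < N" "m' < N" "h m = h m'" for m m'
  proof -
    have c: "m div q = m' div q"
      using disj[OF div_n div_n, OF that(1,2)] hL[OF that(1)] hL[OF that(2)] that(3) by auto
    have "inj_on (e (m div q)) {..<q}" using e[OF div_n[OF that(1)]] by (simp add: bij_betw_def)
    then have "m mod q = m' mod q" using that(3) c q0 by (auto simp: h_def inj_on_def)
    with c show ?thesis by (metis div_mult_mod_eq)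
  qed
  have h_image: "h ` C c = L (vs ! c)" if "c < n" for c
  proof (intro equalityI subsetI)
    fix x assume "x \<in> L (vs ! c)"
    then obtain k where k: "k < q" "x = e c k" using e[OF \<open>c < n\<close>] by (auto simp: bij_betw_def)
    have "c * q + k < Suc c * q" using k by simp
    also have "\<dots> \<le> n * q" using that by (intro mult_right_mono) auto
    finally have "c * q + k \<in> C c" using k by (simp add: C_def N_def)
    moreover have "h (c * q + k) = x" using k by (simp add: h_def)
    ultimately show "x \<in> h ` C c" by blast
  qed (use hL in \<open>auto simp: C_def\<close>)
  have inj_C: "inj_on h X" if "X \<subseteq> {..<N}" for X
    using h_inj that by (auto intro!: inj_onI)
  have C_sub: "C c \<subseteq> {..<N}" for c by (auto simp: C_def)
  have card_C: "card (C c) = q" if "c < n" for c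
    using card_image[OF inj_C[OF C_sub[of c]]] h_image[OF that] fold vsG[OF that] by (simp add: q_fold_def)
  define adj where "adj m m' \<longleftrightarrow> h m \<rightarrow>\<^bsub>H\<^esub> h m'" for m m'
  have adj_sym: "adj m' m" if "adj m m'" for m m'
    using that H.pair_sym_arcs unfolding adj_def symmetric_def sym_def by blast
  have adj_edge: "{h m, h m'} \<in> edge_set (H \<restriction> (L (vs ! (m div q)) \<union> L (vs ! (m' div q))))"
    if "m < N" "m' < N" "adj m m'" for m m'
    unfolding edge_set_restrict using that hL by (auto simp: adj_def)
  have adj_col: "m div q \<noteq> m' div q" if "m < N" "m' < N" "adj m m'" for m m'
  proof
    assume "m div q = m' div q"
    then have "h m \<in> L (vs ! (m div q))" "h m' \<in> L (vs ! (m div q))"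
      using hL[OF that(1)] hL[OF that(2)] by auto
    moreover have "independent_set H (L (vs ! (m div q)))"
      using cover vsG[OF div_n[OF that(1)]] by (simp add: DP_cover_def)
    ultimately show False using that(3) by (auto simp: independent_set_def adj_def)
  qed
  have coverD: "matching (edge_set (H \<restriction> (L (vs ! c) \<union> L (vs ! c'))))"
    "\<not> vs ! c \<rightarrow>\<^bsub>G\<^esub> vs ! c' \<Longrightarrow> edge_set (H \<restriction> (L (vs ! c) \<union> L (vs ! c'))) = {}"
    if "c < n" "c' < n" "c \<noteq> c'" for c c'
    using cover vsG[OF that(1)] vsG[OF that(2)] vs_eq[OF that(1,2)] that(3) by (simp_all add: DP_cover_def)
  have adj_G: "vs ! (m div q) \<rightarrow>\<^bsub>G\<^esub> vs ! (m' div q)" if "m < N" "m' < N" "adj m m'" for m m'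
    using coverD(2)[OF div_n div_n adj_col, OF that(1,2,1,2,3)] adj_edge[OF that] by blast
  have match: "m\<^sub>1 = m\<^sub>2"
    if "m < N" "m\<^sub>1 < N" "m\<^sub>2 < N" "adj m m\<^sub>1" "adj m m\<^sub>2" "m\<^sub>1 div q = m\<^sub>2 div q" for m m\<^sub>1 m\<^sub>2
  proof -
    let ?E = "edge_set (H \<restriction> (L (vs ! (m div q)) \<union> L (vs ! (m\<^sub>1 div q))))"
    have "matching ?E"
      by (rule coverD(1)[OF div_n div_n adj_col, OF that(1,2,1,2,4)])
    moreover have "{h m, h m\<^sub>1} \<in> ?E" by (rule adj_edge[OF that(1,2,4)])
    moreover have "{h m, h m\<^sub>2} \<in> ?E" using adj_edge[OF that(1,3,5)] by (simp only: that(6))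
    moreover have "\<not> disjnt {h m, h m\<^sub>1} {h m, h m\<^sub>2}" by simp
    ultimately have "{h m, h m\<^sub>1} = {h m, h m\<^sub>2}"
      unfolding matching_def by (metis pairwiseD)
    then have "h m\<^sub>1 = h m\<^sub>2" by (auto simp: doubleton_eq_iff)
    then show ?thesis by (rule h_inj[OF that(2,3)])
  qed
  define B where "B m = {j. j < m \<and> m < N \<and> adj j m}" for m
  define R where "R = Id \<union> {(m, m'). m < N \<and> m' < N \<and> adj m m'}"
  have B_lt: "j < N" "m < N" "j < m" "adj j m" if "j \<in> B m" for j m
    using that by (auto simp: B_def)
  have B_col: "j div q < m div q" if "j \<in> B m" for j m
    using adj_col[OF B_lt(1,2,4)[OF that]] div_le_mono[of j m q] B_lt(3)[OF that] by simp
  have B_inj: "inj_on (\<lambda>j. j div q) (B m)" for m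
  proof (rule inj_onI)
    fix j j' assume *: "j \<in> B m" "j' \<in> B m" "j div q = j' div q"
    show "j = j'"
      by (rule match[OF B_lt(2)[OF *(1)] B_lt(1)[OF *(1)] B_lt(1)[OF *(2)]
            adj_sym[OF B_lt(4)[OF *(1)]] adj_sym[OF B_lt(4)[OF *(2)]] *(3)])
  qed
  have B_G: "vs ! (j div q) \<in> back_nbrs G vs (m div q)" if "j \<in> B m" for j m
    using B_col[OF that] adj_G[OF B_lt(1,2,4)[OF that]] unfolding back_nbrs_def by blast
  have finB: "finite (B m)" for m by (simp add: B_def)
  have fin_back: "finite (back_nbrs G vs c)" for c
    by (simp add: back_nbrs_def)
  interpret weight_process B p \<tau>
    using params by unfold_locales (auto simp: B_def)
  have \<rho>_le: "\<rho> \<le> E u (\<lambda>I. prob I u)" if u: "u < N" for u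
  proof -
    let ?c = "u div q"
    have "inj_on (\<lambda>j. vs ! (j div q)) (B u)"
    proof (rule inj_onI)
      fix j j' assume *: "j \<in> B u" "j' \<in> B u" "vs ! (j div q) = vs ! (j' div q)"
      then have "j div q = j' div q"
        using vs_eq[OF div_n[OF B_lt(1)[OF *(1)]] div_n[OF B_lt(1)[OF *(2)]]] by simp
      then show "j = j'" by (rule inj_onD[OF B_inj _ *(1,2)])
    qed
    then have "card (B u) = card ((\<lambda>j. vs ! (j div q)) ` B u)" by (simp add: card_image)
    also have "\<dots> \<le> card (back_nbrs G vs ?c)"
      using B_G by (intro card_mono fin_back) auto
    also have "\<dots> \<le> d"
      using order div_n[OF u] by (simp add: degeneracy_ordering_def n_def)
    finally have deg: "real (card (B u)) \<le> d" by simp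
    \<comment> \<open>The sum of the \<open>card (B u \<inter> B v)\<close> counts the pairs in
      \<open>?P\<close>; each is sent to an edge of \<open>G\<close> among the
      back-neighbours.\<close>
    let ?P = "SIGMA v : B u. B u \<inter> B v"
    let ?g = "\<lambda>(v, x). {vs ! (x div q), vs ! (v div q)}"
    have "inj_on ?g ?P"
    proof (rule inj_onI, clarify)
      fix v x v' x'
      assume *: "v \<in> B u" "x \<in> B u" "x \<in> B v" "v' \<in> B u" "x' \<in> B u" "x' \<in> B v'"
        and eq: "{vs ! (x div q), vs ! (v div q)} = {vs ! (x' div q), vs ! (v' div q)}"
      \<comment> \<open>The strict order of columns fixes which end of the edge is \<open>v\<close>,
        so no edge is hit twice.\<close>
      have lt: "x div q < v div q" "x' div q < v' div q" using * B_col by auto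
      have n: "v div q < n" "x div q < n" "v' div q < n" "x' div q < n"
        using *(1,2,4,5)[THEN B_lt(1)] div_n by simp_all
      from eq have "x div q = x' div q \<and> v div q = v' div q \<or> x div q = v' div q \<and> v div q = x' div q"
        unfolding doubleton_eq_iff vs_eq[OF n(2,4)] vs_eq[OF n(1,3)] vs_eq[OF n(2,3)] vs_eq[OF n(1,4)] .
      with lt have "x div q = x' div q" "v div q = v' div q" by auto
      then show "v = v' \<and> x = x'" using inj_onD[OF B_inj] * by metis
    qed
    then have "card ?P = card (?g ` ?P)" by (simp add: card_image)
    also have "\<dots> \<le> card (edge_set (G \<restriction> back_nbrs G vs ?c))"
    proof (rule card_mono)
      have "edge_set (G \<restriction> back_nbrs G vs ?c) \<subseteq> Pow (back_nbrs G vs ?c)"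
        by (auto simp: edge_set_restrict)
      then show "finite (edge_set (G \<restriction> back_nbrs G vs ?c))"
        using fin_back finite_subset by blast
      have "{vs ! (x div q), vs ! (v div q)} \<in> edge_set (G \<restriction> back_nbrs G vs ?c)"
        if "v \<in> B u" "x \<in> B u" "x \<in> B v" for v x
        unfolding edge_set_restrict using that B_G[OF that(1)] B_G[OF that(2)] adj_G[OF B_lt(1,2,4)[OF that(3)]]
        by blast
      then show "?g ` ?P \<subseteq> edge_set (G \<restriction> back_nbrs G vs ?c)" by auto
    qed
    finally have "(\<Sum>v\<in>B u. card (B u \<inter> B v)) \<le> card (edge_set (G \<restriction> back_nbrs G vs ?c))"
      using finB by simp
    then have "real (\<Sum>v\<in>B u. card (B u \<inter> B v)) \<le> s"
      using sparse[OF div_n[OF u]] by (meson of_nat_mono order_trans)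
    from E_prob_ge[OF params(2,4) deg this] \<rho> show ?thesis by linarith
  qed
  have Id: "Id \<subseteq> R" and BR: "\<And>i j. j \<in> B i \<Longrightarrow> (i, j) \<in> R \<and> (j, i) \<in> R"
    using B_lt(1,2,4) adj_sym unfolding R_def by blast+
  \<comment> \<open>The vertex itself and at most one neighbour in each of the \<open>n\<close>
    lists, independently of \<open>q\<close>.\<close>
  have R_deg: "finite (R `` {x})" "card (R `` {x}) \<le> n + 1" for x
  proof -
    let ?Y = "{y. x < N \<and> y < N \<and> adj x y}"
    have Rx: "R `` {x} = insert x ?Y" by (auto simp: R_def)
    have "inj_on (\<lambda>y. y div q) ?Y"
    proof (rule inj_onI, clarify)
      fix y y' assume "x < N" "y < N" "y' < N" "adj x y" "adj x y'" "y div q = y' div q"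
      then show "y = y'" by (rule match)
    qed
    then have "card ?Y = card ((\<lambda>y. y div q) ` ?Y)" by (simp add: card_image)
    also have "\<dots> \<le> card {..<n}" using div_n by (intro card_mono) auto
    finally have "card ?Y \<le> n" by simp
    moreover have "finite ?Y" by simp
    ultimately show "finite (R `` {x})" "card (R `` {x}) \<le> n + 1"
      unfolding Rx using card_insert_le_m1[of "n + 1" ?Y x] by auto
  qed
  have card_C_le: "card (C c) \<le> q" for c
  proof (cases "c < n")
    case False
    then have "C c = {}" using div_n by (auto simp: C_def)
    then show ?thesis by simp
  qed (simp add: card_C)
  have "\<exists>I\<in>supp N. \<forall>c<n. \<rho> * card (C c) - \<delta> * q \<le> card (I \<inter> C c)"
    unfolding C_def
    by (rule exists_balanced[OF BR Id R_deg B_col div_n card_C_le[unfolded C_def] \<rho>_le \<delta> q])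
  then obtain I where I: "I \<in> supp N" "\<And>c. c < n \<Longrightarrow> \<rho> * card (C c) - \<delta> * q \<le> card (I \<inter> C c)"
    by blast
  have IN: "I \<subseteq> {..<N}" using supp_subset[OF I(1)] .
  have "independent_set H (h ` I)"
    unfolding independent_set_def
  proof (intro conjI ballI)
    show "h ` I \<subseteq> pverts H" using IN hH by auto
    fix x y assume "x \<in> h ` I" "y \<in> h ` I"
    then obtain i j where ij: "i \<in> I" "j \<in> I" "x = h i" "y = h j" by blast
    have "\<not> adj i j"
    proof
      assume a: "adj i j"
      have N: "i < N" "j < N" using ij IN by auto
      have "i \<noteq> j" using adj_col[OF N a] by auto
      then have "i \<in> B j \<or> j \<in> B i" using a adj_sym N by (auto simp: B_def)
      then show False using I(1) ij by (auto simp: supp_def)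
    qed
    then show "\<not> x \<rightarrow>\<^bsub>H\<^esub> y" using ij by (simp add: adj_def)
  qed
  moreover have "(\<rho> - \<delta>) * card (L u) \<le> card (h ` I \<inter> L u)" if "u \<in> pverts G" for u
  proof -
    obtain c where c: "c < n" "u = vs ! c" using \<open>u \<in> pverts G\<close> vs by (metis in_set_conv_nth n_def)
    have "h ` I \<inter> L u = h ` (I \<inter> C c)"
      unfolding c h_image[OF c(1), symmetric] using inj_on_image_Int[OF inj_C[of "{..<N}"] IN C_sub] by simp
    moreover have "inj_on h (I \<inter> C c)" using IN by (intro inj_C) auto
    ultimately have "card (h ` I \<inter> L u) = card (I \<inter> C c)" by (simp add: card_image)
    with I(2)[OF c(1)] card_C[OF c(1)] show ?thesis
      using fold \<open>u \<in> pverts G\<close> by (simp add: q_fold_def algebra_simps)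
  qed
  ultimately show ?thesis unfolding frac_coloring_def by blast
qed

section \<open>Choice of parameters and the final bound\<close>

lemma \<chi>fDP_le:
  assumes "1 \<le> q" "\<eta> \<in> DP_admissible G q" "0 < \<eta>"
  shows "\<chi>fDP G \<le> ereal (1 / \<eta>)"
proof -
  have "\<eta> \<le> \<theta>DP G q"
    unfolding \<theta>DP_def using assms(2) by (rule cSup_upper) (auto intro: bdd_aboveI DP_admissible_le_1)
  then have "inverse (ereal (\<theta>DP G q)) \<le> ereal (1 / \<eta>)"
    using assms(3) by (simp add: inverse_eq_divide frac_le)
  with assms(1) show ?thesis unfolding \<chi>fDP_def by (intro INF_lower2[of q]) auto
qed

text \<open>
  An upper bound for the fraction lost, with \<open>l = ln f\<close>, \<open>p = l / (4 d)\<close>, \<open>\<tau> = sqrt f / (d l)\<close> and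
  \<open>k\<^sub>0 = d / sqrt f\<close>; these give \<open>k\<^sub>0 \<tau> = 1 / l\<close>, and \<open>\<tau> \<le> 2 / l\<close> because \<open>f \<le> d\<^sup>2 + 1\<close>.
\<close>

definition loss :: "real \<Rightarrow> real" where
  "loss l = (l / 4 * exp ((1 / l) / (1 - 2 / l)) + 1 / l) / ((1 - 2 / l) * (l / 2 - 2 * ln l))"

text \<open>Checks the parameter conditions of \<open>frac_coloring_exists\<close> for sparsity
  \<open>d\<^sup>2 / f\<close>. Here \<open>loss l\<close> replaces \<open>\<tau>\<close> by
  \<open>2 / l\<close> and drops \<open>ln 4\<close> from
  \<open>ln (\<tau> / p) = ln 4 + l / 2 - 2 * ln l\<close>.\<close>

lemma loss_bound:
  fixes d f :: real
  defines "l \<equiv> ln f"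
  assumes d: "1 \<le> d" and f: "0 < f" "f \<le> d\<^sup>2 + 1" and l: "4 < l" "0 < l / 2 - 2 * ln l"
  defines "p \<equiv> l / (4 * d)" and "\<tau> \<equiv> sqrt f / (d * l)" and "k\<^sub>0 \<equiv> d / sqrt f"
  shows "0 < p" "p < \<tau>" "\<tau> < 1" "0 < k\<^sub>0"
    and "p * (1 - loss l) \<le>
      p * (1 - (d * p * exp (k\<^sub>0 * \<tau> / (1 - \<tau>)) + \<tau> * (d\<^sup>2 / f) / k\<^sub>0) / ((1 - \<tau>) * ln (\<tau> / p)))"
proof -
  have sf: "0 < sqrt f" "sqrt f * sqrt f = f" using f by simp_all
  have "1 \<le> d\<^sup>2" using d by (simp add: one_le_power)
  then have "sqrt f \<le> sqrt ((2 * d)\<^sup>2)" using f by (intro real_sqrt_le_mono) (simp add: power_mult_distrib)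
  then have sfd: "sqrt f \<le> 2 * d" using d by (simp only: real_sqrt_abs)
  show p: "0 < p" and k0: "0 < k\<^sub>0" using d l sf by (simp_all add: p_def k\<^sub>0_def)
  have tau0: "0 < \<tau>" using d l sf by (simp add: \<tau>_def)
  have "\<tau> \<le> 2 * d / (d * l)" unfolding \<tau>_def using d l sfd by (intro divide_right_mono) auto
  then have tau: "\<tau> \<le> 2 / l" using d by simp
  have l2: "2 / l < 1" using l by simp
  then show tau1: "\<tau> < 1" using tau by simp
  have "\<tau> / p = 4 * sqrt f / l\<^sup>2"
    using d l by (simp add: \<tau>_def p_def power2_eq_square field_simps)
  moreover have "f \<noteq> 1" using l by (auto simp: l_def)
  ultimately have "ln (\<tau> / p) = ln 4 + l / 2 - 2 * ln l"
    using l sf f by (simp add: ln_div ln_mult ln_sqrt ln_realpow l_def)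
  moreover have "0 \<le> ln (4 :: real)" by simp
  ultimately have ln_ge: "l / 2 - 2 * ln l \<le> ln (\<tau> / p)" by linarith
  then have "0 < ln (\<tau> / p)" using l by linarith
  then have "1 < \<tau> / p" using tau0 p by (simp add: ln_gt_zero_iff)
  then show "p < \<tau>" using p by (simp add: field_simps)
  have k0tau: "k\<^sub>0 * \<tau> = 1 / l" using d l sf by (simp add: k\<^sub>0_def \<tau>_def field_simps)
  have dp: "d * p = l / 4" using d by (simp add: p_def)
  have "\<tau> * (d\<^sup>2 / f) / k\<^sub>0 = (sqrt f * sqrt f) / f / l"
    using d l sf by (simp add: k\<^sub>0_def \<tau>_def power2_eq_square field_simps)
  then have ts: "\<tau> * (d\<^sup>2 / f) / k\<^sub>0 = 1 / l" using sf f by simp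
  have "(d * p * exp (k\<^sub>0 * \<tau> / (1 - \<tau>)) + \<tau> * (d\<^sup>2 / f) / k\<^sub>0) / ((1 - \<tau>) * ln (\<tau> / p)) \<le> loss l"
    unfolding loss_def dp ts k0tau
  proof (rule frac_le)
    have "(1 / l) / (1 - \<tau>) \<le> (1 / l) / (1 - 2 / l)"
      using l l2 tau tau1 by (intro divide_left_mono) auto
    then show "l / 4 * exp (1 / l / (1 - \<tau>)) + 1 / l \<le> l / 4 * exp (1 / l / (1 - 2 / l)) + 1 / l"
      using l by simp
    show "(1 - 2 / l) * (l / 2 - 2 * ln l) \<le> (1 - \<tau>) * ln (\<tau> / p)"
      using tau ln_ge l l2 tau1 by (intro mult_mono) auto
    show "0 < (1 - 2 / l) * (l / 2 - 2 * ln l)" using l l2 by simp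
    show "0 \<le> l / 4 * exp (1 / l / (1 - 2 / l)) + 1 / l" using l by simp
  qed
  then show "p * (1 - loss l) \<le>
      p * (1 - (d * p * exp (k\<^sub>0 * \<tau> / (1 - \<tau>)) + \<tau> * (d\<^sup>2 / f) / k\<^sub>0) / ((1 - \<tau>) * ln (\<tau> / p)))"
    using p by (intro mult_left_mono) auto
qed

theorem theorem1p13:
  fixes \<epsilon> :: real
  assumes "0 < \<epsilon>" and "\<epsilon> < 1"
  shows "\<exists>C>0. \<exists>d\<^sub>0 :: nat. \<forall>d\<ge>d\<^sub>0. \<forall>f :: real. C \<le> f \<and> f \<le> (real d)\<^sup>2 + 1 \<longrightarrow>
    (\<forall>G :: 'a pair_pre_digraph.
       pair_graph G \<and> degenerate d G \<and>
       (\<exists>vs. degeneracy_ordering d G vs \<and> left_locally_sparse ((real d)\<^sup>2 / f) G vs) \<longrightarrow>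
       \<chi>fDP G \<le> ereal ((8 + \<epsilon>) * (real d / ln f)))"
proof -
  \<comment> \<open>For large \<open>l\<close> the numerator of \<open>loss l\<close> behaves like
    \<open>l / 4\<close> and the denominator like \<open>l / 2\<close>. Hence a density of about
    \<open>(1 - 1 / 2) / 4 = 1 / 8\<close> times \<open>l / d\<close> survives, the source of the
    constant 8.\<close>
  have "(loss \<longlongrightarrow> 1 / 2) at_top" unfolding loss_def by real_asymp
  then have "((\<lambda>l. (1 - loss l) / 4) \<longlongrightarrow> (1 - 1 / 2) / 4) at_top"
    by (intro tendsto_intros) auto
  moreover have "1 / (8 + \<epsilon>) < (1 - 1 / 2) / 4" using assms by (simp add: field_simps)
  ultimately have "\<forall>\<^sub>F l in at_top. 1 / (8 + \<epsilon>) < (1 - loss l) / 4" by (rule order_tendstoD)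
  moreover have "\<forall>\<^sub>F l :: real in at_top. 0 < l / 2 - 2 * ln l" by real_asymp
  moreover have "\<forall>\<^sub>F l :: real in at_top. 4 < l" by (rule eventually_gt_at_top)
  ultimately have "\<forall>\<^sub>F l in at_top. 1 / (8 + \<epsilon>) < (1 - loss l) / 4 \<and> 0 < l / 2 - 2 * ln l \<and> 4 < l"
    by eventually_elim simp
  then obtain l\<^sub>0 where l0: "\<And>l. l\<^sub>0 \<le> l \<Longrightarrow>
      1 / (8 + \<epsilon>) < (1 - loss l) / 4 \<and> 0 < l / 2 - 2 * ln l \<and> 4 < l"
    unfolding eventually_at_top_linorder by blast
  show ?thesis
  \<comment> \<open>\<open>exp l\<^sub>0\<close> turns the lower bound on \<open>f\<close> into
    \<open>l\<^sub>0 \<le> ln f\<close>; \<open>d \<ge> 1\<close> suffices because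
    \<open>f \<le> d\<^sup>2 + 1\<close> already ties the size of \<open>d\<close> to
    \<open>f\<close>.\<close>
  proof (intro exI[of _ "exp l\<^sub>0"] exI[of _ "1 :: nat"] conjI allI impI)
    fix d :: nat and f :: real and G :: "'a pair_pre_digraph"
    assume d: "1 \<le> d" and f: "exp l\<^sub>0 \<le> f \<and> f \<le> (real d)\<^sup>2 + 1"
      and G: "pair_graph G \<and> degenerate d G \<and>
       (\<exists>vs. degeneracy_ordering d G vs \<and> left_locally_sparse ((real d)\<^sup>2 / f) G vs)"
    have f0: "0 < f" using f exp_gt_zero[of l\<^sub>0] by linarith
    define l where "l = ln f"
    have "l\<^sub>0 \<le> l" using f f0 by (simp add: l_def ln_ge_iff)
    from l0[OF this] have l: "1 / (8 + \<epsilon>) < (1 - loss l) / 4" "0 < l / 2 - 2 * ln l" "4 < l" by auto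
    obtain vs where vs: "degeneracy_ordering d G vs" "left_locally_sparse ((real d)\<^sup>2 / f) G vs"
      using G by blast
    define n where "n = length vs"
    have sparse: "real (card (edge_set (G \<restriction> back_nbrs G vs i))) \<le> (real d)\<^sup>2 / f" if "i < length vs" for i
      using vs(2) that unfolding left_locally_sparse_def by (metis le_floor_iff of_int_of_nat_eq)
    define p where "p = l / (4 * real d)"
    \<comment> \<open>\<open>\<eta>\<close> is the reciprocal of the target bound, and
      \<open>\<delta>\<close> is the slack between it and the density guaranteed in
      expectation.\<close>
    define \<eta> where "\<eta> = l / ((8 + \<epsilon>) * real d)"
    define \<delta> where "\<delta> = p * (1 - loss l) - \<eta>"
    have "l / d * (1 / (8 + \<epsilon>)) < l / d * ((1 - loss l) / 4)"
      using l d by (intro mult_strict_left_mono) auto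
    then have \<delta>: "0 < \<delta>" by (simp add: \<delta>_def p_def \<eta>_def mult.commute)
    have \<eta>0: "0 < \<eta>" using l d assms by (simp add: \<eta>_def)
    have "0 < \<delta>\<^sup>2" using \<delta> by simp
    \<comment> \<open>\<open>q\<close> depends only on \<open>n\<close> and \<open>\<delta>\<close>,
      so it is fixed before the cover is given.\<close>
    from ex_less_of_nat_mult[OF this] obtain q :: nat
      where q: "real (n * (n + 1) ^ (2 * n)) < \<delta>\<^sup>2 * real q" by (metis mult.commute)
    have q1: "1 \<le> q" using pos_if_less_mult[OF q] by simp
    \<comment> \<open>\<open>\<eta> \<le> 1\<close> will follow from
      \<open>ln f = 2 * ln (sqrt f) \<le> 2 * sqrt f \<le> 4 * d\<close>.\<close>
    have "1 \<le> (real d)\<^sup>2" using d by (simp add: one_le_power)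
    then have "sqrt f \<le> sqrt ((2 * real d)\<^sup>2)"
      using f by (intro real_sqrt_le_mono) (simp add: power_mult_distrib)
    then have "sqrt f \<le> 2 * d" by (simp only: real_sqrt_abs)
    moreover have "ln (sqrt f) \<le> sqrt f - 1" using f0 by (intro ln_le_minus_one) simp
    ultimately have "l \<le> 4 * real d" using f0 by (simp add: ln_sqrt l_def)
    also have "\<dots> \<le> (8 + \<epsilon>) * real d" using assms by (intro mult_right_mono) auto
    finally have \<eta>1: "\<eta> \<le> 1" using assms d by (simp add: \<eta>_def)
    have d': "1 \<le> real d" using d by simp
    note bounds = loss_bound[OF d' f0 f[THEN conjunct2], folded l_def, OF l(3,2)]
    have "\<exists>S. frac_coloring G \<eta> L H S" if "DP_cover G L H" "q_fold G q L" for L :: "'a \<Rightarrow> nat set" and H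
      using frac_coloring_exists[OF vs(1) sparse that bounds \<delta> q[unfolded n_def]]
      by (simp add: \<delta>_def p_def)
    then have "\<eta> \<in> DP_admissible G q" using \<eta>0 \<eta>1 by (simp add: DP_admissible_def)
    from \<chi>fDP_le[OF q1 this \<eta>0] show "\<chi>fDP G \<le> ereal ((8 + \<epsilon>) * (real d / ln f))"
      by (simp add: \<eta>_def l_def)
  qed simp
qed

end
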